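(* For every graded poset $P$ of rank at least $1$, the $\mathbf{ab}$-index of the Tchebyshev transform $T(P)$ of $P$ is given by $$\Psi(T(P)) = T(\Psi(P)\cdot \mathbf{a}),$$ where on the right-hand side $T$ denotes the linear operator $T:\mathbb{Z}\langle \mathbf{a},\mathbf{b}\rangle\to\mathbb{Z}\langle \mathbf{a},\mathbf{b}\rangle$ defined in the context.
   Context: All graded posets are finite, with minimal element $\widehat{0}$, maximal element $\widehat{1}$ and rank function $\rho$; $\rho(x,y)=\rho(y)-\rho(x)$, and $\rho(P)=\rho(\widehat 1)$. Let $\mathbb{Z}\langle \mathbf{a},\mathbf{b}\rangle$ be the ring of polynomials in noncommuting variables $\mathbf{a},\mathbf{b}$, each of degree $1$. For a graded poset $P$ of rank at least $1$, the weight of a chain $c=\{\widehat 0=x_0<x_1<\cdots<x_k=\widehat 1\}$ is $\mathrm{wt}(c)=(\mathbf{a}-\mathbf{b})^{\rho(x_0,x_1)-1}\cdot\mathbf{b}\cdot(\mathbf{a}-\mathbf{b})^{\rho(x_1,x_2)-1}\cdot\mathbf{b}\cdots\mathbf{b}\cdot(\mathbf{a}-\mathbf{b})^{\rho(x_{k-1},x_k)-1}$, and the $\mathbf{ab}$-index of $P$ is $\Psi(P)=\sum_c \mathrm{wt}(c)$, the sum over all such chains in $P$. Tchebyshev transform of a poset: let $P\cup\{\widehat{-1}\}$ be $P$ with a new minimal element $\widehat{-1}$ adjoined. $T(P)$ is the graded poset with elements $[x,y]$ for $x,y\in P\cup\{\widehat{-1}\}$, $x<y$, together with a maximal element $\widehat{1}_{T(P)}$,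 with cover relations: (i) $[x,y]\prec[y,w]$ if $y\prec w$; (ii) $[x,y]\prec[x,w]$ if $y\prec w$; (iii) $[x,\widehat 1]\prec\widehat{1}_{T(P)}$. Its minimal element is $[\widehat{-1},\widehat 0]$, and $\rho([x,y])=\rho_P(y)$, $\rho(\widehat 1_{T(P)})=\rho(P)+1$. Coproduct: for a monomial $u_1\cdots u_n$ (each $u_i\in\{\mathbf{a},\mathbf{b}\}$), $\Delta(u_1\cdots u_n)=\sum_{i=1}^n u_1\cdots u_{i-1}\otimes u_{i+1}\cdots u_n$ (so $\Delta(1)=0$), extended linearly; it is coassociative. $\Delta^1=\mathrm{id}$, $\Delta^{k+1}=(\mathrm{id}\otimes\Delta^k)\circ\Delta$, and Sweedler notation $\Delta^k(u)=\sum_u u_{(1)}\otimes\cdots\otimes u_{(k)}$ is used. Operators: $A:\mathbb{Z}\langle\mathbf{a},\mathbf{b}\rangle\to\mathbb{Z}$ is the algebra map with $A(\mathbf{a})=1$, $A(\mathbf{b})=0$; $C(u)=2A(u)+\sum_u A(u_{(1)})A(u_{(2)})$ (coproduct into $2$ parts). For homogeneous $u$, $\kappa(u)=A(u)(\mathbf{a}-\mathbf{b})^{\deg u}$ and $\nu(u)=C(u)(\mathbf{a}-\mathbf{b})^{\deg u}$, extended linearly. Then $T(u)=\sum_{k\ge1}\sum_u \nu(u_{(1)})\cdot\mathbf{b}\cdot\nu(u_{(2)})\cdot\mathbf{b}\cdots\mathbf{b}\cdot\nu(u_{(k-1)})\cdot\mathbf{b}\cdot\kappa(u_{(k)})$,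 the coproduct being into $k$ parts. *)

theory Defs
  imports "HOL-Library.Poly_Mapping"
begin

section \<open>Noncommutative polynomials in two variables\<close>

datatype letter = La | Lb

type_synonym word = "letter list"

text \<open>
  Words form the free monoid under concatenation. The product of type
  \<^typ>\<open>'m \<Rightarrow>\<^sub>0 int\<close> is convolution over an additively written monoid \<^typ>\<open>'m\<close>,
  hence concatenation is written as addition here.
\<close>

instantiation list :: (type) monoid_add
begin

definition zero_list_def: "(0 :: 'a list) = []"

definition plus_list_def: "(xs :: 'a list) + ys = xs @ ys"

instance
  by standard (simp_all add: zero_list_def plus_list_def)

end

type_synonym ab_poly = "word \<Rightarrow>\<^sub>0 int"

definition var_a :: ab_poly where "var_a = frag_of [La]"

definition var_b :: ab_poly where "var_b = frag_of [Lb]"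

lemma one_eq_frag_of: "(1 :: ab_poly) = frag_of []"
  by (simp add: zero_list_def flip: single_one)

lemma frag_of_mult: "(frag_of v :: ab_poly) * frag_of w = frag_of (v @ w)"
  by (simp add: mult_single plus_list_def)

lemma frag_of_Cons:
  "(frag_of (l # w) :: ab_poly) = (case l of La \<Rightarrow> var_a | Lb \<Rightarrow> var_b) * frag_of w"
  by (simp add: var_a_def var_b_def frag_of_mult split: letter.split)


section \<open>Graded posets and the ab-index\<close>

record 'a gposet =
  gp_elts :: "'a set"
  gp_le :: "('a \<times> 'a) set"
  gp_rank :: "'a \<Rightarrow> nat"

definition covers :: "('a \<times> 'a) set \<Rightarrow> 'a \<Rightarrow> 'a \<Rightarrow> bool" where
  "covers r x y \<longleftrightarrow> (x, y) \<in> r \<and> x \<noteq> y \<and>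
     (\<nexists>z. z \<noteq> x \<and> z \<noteq> y \<and> (x, z) \<in> r \<and> (z, y) \<in> r)"

definition is_bot :: "'a gposet \<Rightarrow> 'a \<Rightarrow> bool" where
  "is_bot P z \<longleftrightarrow> z \<in> gp_elts P \<and> (\<forall>x\<in>gp_elts P. (z, x) \<in> gp_le P)"

definition is_top :: "'a gposet \<Rightarrow> 'a \<Rightarrow> bool" where
  "is_top P t \<longleftrightarrow> t \<in> gp_elts P \<and> (\<forall>x\<in>gp_elts P. (x, t) \<in> gp_le P)"

definition gp_bot :: "'a gposet \<Rightarrow> 'a" where
  "gp_bot P = (THE z. is_bot P z)"

definition gp_top :: "'a gposet \<Rightarrow> 'a" where
  "gp_top P = (THE t. is_top P t)"

definition graded_poset :: "'a gposet \<Rightarrow> bool" where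
  "graded_poset P \<longleftrightarrow>
     finite (gp_elts P) \<and> partial_order_on (gp_elts P) (gp_le P) \<and>
     (\<exists>z. is_bot P z) \<and> (\<exists>t. is_top P t) \<and>
     gp_rank P (gp_bot P) = 0 \<and>
     (\<forall>x y. covers (gp_le P) x y \<longrightarrow> gp_rank P y = Suc (gp_rank P x))"

definition poset_rank :: "'a gposet \<Rightarrow> nat" where
  "poset_rank P = gp_rank P (gp_top P)"

text \<open>Chains from the minimal to the maximal element, listed increasingly.\<close>

definition chains :: "'a gposet \<Rightarrow> 'a list set" where
  "chains P = {c. c \<noteq> [] \<and> set c \<subseteq> gp_elts P \<and> hd c = gp_bot P \<and> last c = gp_top P \<and>
                  sorted_wrt (\<lambda>x y. (x, y) \<in> gp_le P \<and> x \<noteq> y) c}"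

text \<open>
  In rank at least 1 all chains have at least two elements; the first two equations
  are then never used on a whole chain.
\<close>

fun chain_weight :: "('a \<Rightarrow> nat) \<Rightarrow> 'a list \<Rightarrow> ab_poly" where
  "chain_weight r [] = 0"
| "chain_weight r [x] = 0"
| "chain_weight r [x, y] = (var_a - var_b) ^ (r y - r x - 1)"
| "chain_weight r (x # y # z # c) =
     (var_a - var_b) ^ (r y - r x - 1) * var_b * chain_weight r (y # z # c)"

definition ab_index :: "'a gposet \<Rightarrow> ab_poly" where
  "ab_index P = (\<Sum>c\<in>chains P. chain_weight (gp_rank P) c)"


section \<open>The Tchebyshev transform of a poset\<close>

datatype 'a adjoined = MinusOne | Old 'a

definition adj_le :: "'a gposet \<Rightarrow> ('a adjoined \<times> 'a adjoined) set" where
  "adj_le P = {(MinusOne, MinusOne)} \<union> {(MinusOne, Old y) | y. y \<in> gp_elts P} \<union>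
              {(Old x, Old y) | x y. (x, y) \<in> gp_le P}"

datatype 'a tcheb = Ivl "'a adjoined" "'a adjoined" | TTop

definition tcheb_elts :: "'a gposet \<Rightarrow> 'a tcheb set" where
  "tcheb_elts P = {Ivl x y | x y. (x, y) \<in> adj_le P \<and> x \<noteq> y} \<union> {TTop}"

definition tcheb_cover :: "'a gposet \<Rightarrow> ('a tcheb \<times> 'a tcheb) set" where
  "tcheb_cover P =
     {(Ivl x y, Ivl y w) | x y w. Ivl x y \<in> tcheb_elts P \<and> covers (adj_le P) y w} \<union>
     {(Ivl x y, Ivl x w) | x y w. Ivl x y \<in> tcheb_elts P \<and> covers (adj_le P) y w} \<union>
     {(Ivl x (Old (gp_top P)), TTop) | x. Ivl x (Old (gp_top P)) \<in> tcheb_elts P}"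

text \<open>The value at \<open>Ivl x MinusOne\<close> is irrelevant, as this is not an element.\<close>

fun tcheb_rank :: "'a gposet \<Rightarrow> 'a tcheb \<Rightarrow> nat" where
  "tcheb_rank P (Ivl x (Old y)) = gp_rank P y"
| "tcheb_rank P (Ivl x MinusOne) = 0"
| "tcheb_rank P TTop = poset_rank P + 1"

definition tchebyshev :: "'a gposet \<Rightarrow> 'a tcheb gposet" where
  "tchebyshev P =
     \<lparr>gp_elts = tcheb_elts P,
      gp_le = {(s, t). s \<in> tcheb_elts P \<and> t \<in> tcheb_elts P \<and> (s, t) \<in> (tcheb_cover P)\<^sup>*},
      gp_rank = tcheb_rank P\<rparr>"


section \<open>Coproduct and the Tchebyshev operator\<close>

text \<open>
  The tensor square of the polynomial ring is free on pairs of words, its \<open>k\<close>-th tensor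
  power is free on lists of \<open>k\<close> words. \<^const>\<open>frag_extend\<close> is linear extension from a basis.
\<close>

definition coprod :: "ab_poly \<Rightarrow> (word \<times> word \<Rightarrow>\<^sub>0 int)" where
  "coprod = frag_extend (\<lambda>w. \<Sum>i<length w. frag_of (take i w, drop (Suc i) w))"

text \<open>\<open>coprod_iter k\<close> is the coproduct into \<open>k\<close> parts; the value at \<open>k = 0\<close> is a dummy.\<close>

fun coprod_iter :: "nat \<Rightarrow> ab_poly \<Rightarrow> (word list \<Rightarrow>\<^sub>0 int)" where
  "coprod_iter 0 u = 0"
| "coprod_iter (Suc 0) u = frag_extend (\<lambda>w. frag_of [w]) u"
| "coprod_iter (Suc (Suc k)) u =
     frag_extend (\<lambda>(v, w). frag_extend (\<lambda>ws. frag_of (v # ws)) (coprod_iter (Suc k) (frag_of w)))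
       (coprod u)"

text \<open>Linear extension of an integer-valued function on a basis.\<close>

definition int_extend :: "('b \<Rightarrow> int) \<Rightarrow> ('b \<Rightarrow>\<^sub>0 int) \<Rightarrow> int" where
  "int_extend f u = (\<Sum>i\<in>Poly_Mapping.keys u. Poly_Mapping.lookup u i * f i)"

definition A_op :: "ab_poly \<Rightarrow> int" where
  "A_op = int_extend (\<lambda>w. prod_list (map (\<lambda>l. case l of La \<Rightarrow> 1 | Lb \<Rightarrow> 0) w))"

definition C_op :: "ab_poly \<Rightarrow> int" where
  "C_op u = 2 * A_op u + int_extend (\<lambda>(v, w). A_op (frag_of v) * A_op (frag_of w)) (coprod u)"

definition kappa :: "ab_poly \<Rightarrow> ab_poly" where
  "kappa = frag_extend (\<lambda>w. frag_cmul (A_op (frag_of w)) ((var_a - var_b) ^ length w))"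

definition nu :: "ab_poly \<Rightarrow> ab_poly" where
  "nu = frag_extend (\<lambda>w. frag_cmul (C_op (frag_of w)) ((var_a - var_b) ^ length w))"

text \<open>The summand of the Tchebyshev operator on a basis tensor; the empty list is a dummy case.\<close>

fun tcheb_tensor :: "word list \<Rightarrow> ab_poly" where
  "tcheb_tensor [] = 0"
| "tcheb_tensor [w] = kappa (frag_of w)"
| "tcheb_tensor (w # w' # ws) = nu (frag_of w) * var_b * tcheb_tensor (w' # ws)"

text \<open>
  \<^const>\<open>Sum_any\<close> sums the nonzero terms; lemma \<open>finite_tcheb_support\<close> below shows that there are
  finitely many. The summation index is shifted: there are \<open>Suc k\<close> parts.
\<close>

definition tcheb_op :: "ab_poly \<Rightarrow> ab_poly" where
  "tcheb_op u = Sum_any (\<lambda>k. frag_extend tcheb_tensor (coprod_iter (Suc k) u))"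


section \<open>Well-definedness of the above notions\<close>

lemma frag_induct [case_names zero one diff]:
  assumes "Q 0" "\<And>x. Q (frag_of x)" "\<And>a b. Q a \<Longrightarrow> Q b \<Longrightarrow> Q (a - b)"
  shows "Q c"
  by (rule frag_induction [OF subset_UNIV]) (use assms in auto)

lemma int_extend_0 [simp]: "int_extend f 0 = 0"
  by (simp add: int_extend_def)

lemma int_extend_of [simp]: "int_extend f (frag_of x) = f x"
  by (simp add: int_extend_def)

lemma int_extend_superset:
  assumes "finite K" "Poly_Mapping.keys u \<subseteq> K"
  shows "int_extend f u = (\<Sum>i\<in>K. Poly_Mapping.lookup u i * f i)"
  unfolding int_extend_def
  by (rule sum.mono_neutral_left) (use assms in \<open>auto simp: in_keys_iff\<close>)

lemma int_extend_diff: "int_extend f (u - v) = int_extend f u - int_extend f v"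
proof -
  let ?K = "Poly_Mapping.keys u \<union> Poly_Mapping.keys v"
  have "Poly_Mapping.keys (u - v) \<subseteq> ?K"
    by (auto simp: in_keys_iff lookup_minus)
  then show ?thesis
    by (simp add: int_extend_superset [of ?K] lookup_minus left_diff_distrib sum_subtractf)
qed

lemma A_op_var: "A_op var_a = 1" "A_op var_b = 0" "A_op 1 = 1"
  by (simp_all add: A_op_def var_a_def var_b_def one_eq_frag_of)

lemma A_op_diff: "A_op (u - v) = A_op u - A_op v"
  by (simp add: A_op_def int_extend_diff)

lemma A_op_mult: "A_op (u * v) = A_op u * A_op v"
proof -
  have base: "A_op (frag_of w * v) = A_op (frag_of w) * A_op v" for w
  proof (induction v rule: frag_induct)
    case (one x)
    then show ?case by (simp add: frag_of_mult A_op_def)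
  next
    case (diff a b)
    then show ?case by (simp add: A_op_diff right_diff_distrib)
  next
    case zero
    then show ?case by (simp add: A_op_def)
  qed
  show ?thesis
  proof (induction u rule: frag_induct)
    case (one x)
    then show ?case by (simp add: base)
  next
    case (diff a b)
    then show ?case by (simp add: A_op_diff left_diff_distrib)
  next
    case zero
    then show ?case by (simp add: A_op_def)
  qed
qed

lemma sum_frag_cmul: "(\<Sum>i\<in>I. frag_cmul (c i) p) = frag_cmul (\<Sum>i\<in>I. c i) p"
  by (induction I rule: infinite_finite_induct) (simp_all add: frag_cmul_distrib)

lemma kappa_homogeneous:
  assumes "\<And>w. w \<in> Poly_Mapping.keys u \<Longrightarrow> length w = n"
  shows "kappa u = frag_cmul (A_op u) ((var_a - var_b) ^ n)"
proof -
  have "kappa u = (\<Sum>w\<in>Poly_Mapping.keys u.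
      frag_cmul (Poly_Mapping.lookup u w * A_op (frag_of w)) ((var_a - var_b) ^ n))"
    using assms by (simp add: kappa_def frag_extend_def)
  also have "\<dots> = frag_cmul (\<Sum>w\<in>Poly_Mapping.keys u. Poly_Mapping.lookup u w * A_op (frag_of w))
      ((var_a - var_b) ^ n)"
    by (rule sum_frag_cmul)
  finally show ?thesis
    by (simp add: A_op_def int_extend_def [of _ u])
qed

lemma C_op_diff: "C_op (u - v) = C_op u - C_op v"
  by (simp add: C_op_def A_op_diff coprod_def frag_extend_diff int_extend_diff)

lemma int_functional_expand:
  fixes F :: "('b \<Rightarrow>\<^sub>0 int) \<Rightarrow> int"
  assumes diff: "\<And>u v. F (u - v) = F u - F v"
  shows "F u = int_extend (\<lambda>w. F (frag_of w)) u"
  using diff [of 0 0]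
  by (induction u rule: frag_induct) (simp_all add: diff int_extend_diff)

lemma nu_homogeneous:
  assumes "\<And>w. w \<in> Poly_Mapping.keys u \<Longrightarrow> length w = n"
  shows "nu u = frag_cmul (C_op u) ((var_a - var_b) ^ n)"
proof -
  have "nu u = (\<Sum>w\<in>Poly_Mapping.keys u.
      frag_cmul (Poly_Mapping.lookup u w * C_op (frag_of w)) ((var_a - var_b) ^ n))"
    using assms by (simp add: nu_def frag_extend_def)
  also have "\<dots> = frag_cmul (\<Sum>w\<in>Poly_Mapping.keys u. Poly_Mapping.lookup u w * C_op (frag_of w))
      ((var_a - var_b) ^ n)"
    by (rule sum_frag_cmul)
  finally show ?thesis
    by (simp add: int_functional_expand [OF C_op_diff, of u] int_extend_def)
qed

lemma coprod_iter_eq_0: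
  "length w < k \<Longrightarrow> coprod_iter (Suc k) (frag_of w) = 0"
proof (induction k arbitrary: w)
  case (Suc k)
  have "coprod_iter (Suc k) (frag_of (drop (Suc i) w)) = 0" if "i < length w" for i
    using Suc that by auto
  then show ?case
    by (simp add: coprod_def frag_extend_sum o_def)
qed simp

lemma coprod_iter_diff: "coprod_iter k (u - v) = coprod_iter k u - coprod_iter k v"
  by (cases "(k, u)" rule: coprod_iter.cases) (simp_all add: coprod_def frag_extend_diff)

lemma finite_tcheb_support:
  "finite {k. frag_extend tcheb_tensor (coprod_iter (Suc k) u) \<noteq> 0}"
proof -
  have "\<exists>n. \<forall>k>n. coprod_iter (Suc k) u = 0"
  proof (induction u rule: frag_induct)
    case zero
    have "coprod_iter (Suc k) 0 = 0" for k
      using coprod_iter_diff [of "Suc k" 0 0] by simp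
    then show ?case by blast
  next
    case (one w)
    then show ?case using coprod_iter_eq_0 by blast
  next
    case (diff a b)
    then obtain m n where "\<forall>k>m. coprod_iter (Suc k) a = 0" "\<forall>k>n. coprod_iter (Suc k) b = 0"
      by blast
    then have "\<forall>k>max m n. coprod_iter (Suc k) (a - b) = 0"
      by (simp only: coprod_iter_diff) simp
    then show ?case by blast
  qed
  then obtain n where "\<forall>k>n. coprod_iter (Suc k) u = 0" by blast
  then have "{k. frag_extend tcheb_tensor (coprod_iter (Suc k) u) \<noteq> 0} \<subseteq> {..n}"
    by (metis (mono_tags, lifting) atMost_iff frag_extend_0 linorder_not_le mem_Collect_eq subsetI)
  then show ?thesis
    using finite_subset by blast
qed

lemma finite_chains:
  assumes "finite (gp_elts P)"
  shows "finite (chains P)"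
proof -
  have "distinct c" if "sorted_wrt (\<lambda>x y. (x, y) \<in> gp_le P \<and> x \<noteq> y) c" for c
    using that by (induction c) auto
  then have "chains P \<subseteq> {c. set c \<subseteq> gp_elts P \<and> distinct c}"
    by (auto simp: chains_def)
  then show ?thesis
    using assms finite_subset_distinct finite_subset by blast
qed

lemma gp_bot_eq: "partial_order_on (gp_elts P) (gp_le P) \<Longrightarrow> is_bot P z \<Longrightarrow> gp_bot P = z"
  unfolding gp_bot_def by (rule the_equality) (auto simp: is_bot_def partial_order_on_def antisym_def)

lemma gp_top_eq: "partial_order_on (gp_elts P) (gp_le P) \<Longrightarrow> is_top P t \<Longrightarrow> gp_top P = t"
  unfolding gp_top_def by (rule the_equality) (auto simp: is_top_def partial_order_on_def antisym_def)

context
  fixes P :: "'a gposet"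
  assumes P: "graded_poset P"
begin

lemma P_order: "partial_order_on (gp_elts P) (gp_le P)"
  and P_finite: "finite (gp_elts P)"
  and P_rank_bot: "gp_rank P (gp_bot P) = 0"
  using P by (simp_all add: graded_poset_def)

lemma P_rank_cover: "covers (gp_le P) x y \<Longrightarrow> gp_rank P y = Suc (gp_rank P x)"
  using P by (simp add: graded_poset_def)

lemma P_bot: "is_bot P (gp_bot P)"
  using P gp_bot_eq [OF P_order] unfolding graded_poset_def by metis

lemma P_top: "is_top P (gp_top P)"
  using P gp_top_eq [OF P_order] unfolding graded_poset_def by metis

lemma P_sub: "(x, y) \<in> gp_le P \<Longrightarrow> x \<in> gp_elts P \<and> y \<in> gp_elts P"
  using partial_order_onD(4) [OF P_order] by blast

lemma P_refl: "x \<in> gp_elts P \<Longrightarrow> (x, x) \<in> gp_le P"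
  using partial_order_onD(1) [OF P_order] by (rule refl_onD)

lemma P_antisym: "(x, y) \<in> gp_le P \<Longrightarrow> (y, x) \<in> gp_le P \<Longrightarrow> x = y"
  using partial_order_onD(3) [OF P_order] by (rule antisymD)

lemma P_trans: "(x, y) \<in> gp_le P \<Longrightarrow> (y, z) \<in> gp_le P \<Longrightarrow> (x, z) \<in> gp_le P"
  using partial_order_onD(2) [OF P_order] by (rule transD)

lemma adj_le_simps [simp]:
  "(Old x, Old y) \<in> adj_le P \<longleftrightarrow> (x, y) \<in> gp_le P"
  "(MinusOne, Old y) \<in> adj_le P \<longleftrightarrow> y \<in> gp_elts P"
  "(z, MinusOne) \<in> adj_le P \<longleftrightarrow> z = MinusOne"
  by (auto simp: adj_le_def)

lemma ex_adjoined: "(\<exists>z. Q z) \<longleftrightarrow> Q MinusOne \<or> (\<exists>z. Q (Old z))"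
  by (metis adjoined.exhaust)

lemma adj_covers_Old: "covers (adj_le P) (Old x) (Old y) \<longleftrightarrow> covers (gp_le P) x y"
  by (simp add: covers_def ex_adjoined)

lemma adj_covers_MinusOne: "covers (adj_le P) MinusOne (Old y) \<longleftrightarrow> y = gp_bot P"
proof
  assume c: "covers (adj_le P) MinusOne (Old y)"
  then have "y \<in> gp_elts P" by (auto simp: covers_def adj_le_def)
  then have "(gp_bot P, y) \<in> gp_le P" "gp_bot P \<in> gp_elts P" using P_bot by (auto simp: is_bot_def)
  then show "y = gp_bot P"
    using c unfolding covers_def adj_le_def by auto
next
  assume "y = gp_bot P"
  then show "covers (adj_le P) MinusOne (Old y)"
    using P_bot P_antisym unfolding covers_def adj_le_def is_bot_def by auto
qed

lemma not_adj_le_MinusOne: "(x, MinusOne) \<in> adj_le P \<longleftrightarrow> x = MinusOne"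
  by (auto simp: adj_le_def)

lemma tcheb_elts_cases:
  assumes "s \<in> tcheb_elts P"
  obtains "s = TTop"
  | x y where "s = Ivl x (Old y)" "(x, Old y) \<in> adj_le P" "x \<noteq> Old y" "y \<in> gp_elts P"
proof -
  consider "s = TTop" | x y where "s = Ivl x y" "(x, y) \<in> adj_le P" "x \<noteq> y"
    using assms by (auto simp: tcheb_elts_def)
  then show thesis
  proof cases
    case 2
    then obtain y' where y': "y = Old y'"
      by (cases y) (auto simp: not_adj_le_MinusOne)
    then have "y' \<in> gp_elts P"
      using 2 P_sub by (auto simp: adj_le_def)
    then show ?thesis using that 2 y' by blast
  qed (use that in blast)
qed

lemma adj_trans: "(x, y) \<in> adj_le P \<Longrightarrow> (y, z) \<in> adj_le P \<Longrightarrow> (x, z) \<in> adj_le P"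
  unfolding adj_le_def using P_trans P_sub by auto

lemma adj_antisym: "(x, y) \<in> adj_le P \<Longrightarrow> (y, x) \<in> adj_le P \<Longrightarrow> x = y"
  unfolding adj_le_def using P_antisym by auto

lemma tcheb_cover_rank:
  assumes "(s, t) \<in> tcheb_cover P"
  shows "s \<in> tcheb_elts P \<and> t \<in> tcheb_elts P \<and> tcheb_rank P t = Suc (tcheb_rank P s)"
proof -
  consider x y w where "s = Ivl x y" "t = Ivl y w \<or> t = Ivl x w"
      "Ivl x y \<in> tcheb_elts P" "covers (adj_le P) y w"
    | x where "s = Ivl x (Old (gp_top P))" "t = TTop" "s \<in> tcheb_elts P"
    using assms unfolding tcheb_cover_def by auto
  then show ?thesis
  proof cases
    case 1
    then have xy: "(x, y) \<in> adj_le P" "x \<noteq> y" and yw: "(y, w) \<in> adj_le P" "y \<noteq> w"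
      by (auto simp: tcheb_elts_def covers_def)
    obtain y' where y: "y = Old y'"
      using xy not_adj_le_MinusOne by (cases y) auto
    obtain w' where w: "w = Old w'"
      using yw y by (cases w) (auto simp: not_adj_le_MinusOne)
    have "t \<in> tcheb_elts P"
      using 1(2) xy yw adj_trans adj_antisym unfolding tcheb_elts_def by blast
    moreover have "gp_rank P w' = Suc (gp_rank P y')"
      using 1(4) P_rank_cover unfolding y w adj_covers_Old by blast
    ultimately show ?thesis
      using 1 y w by auto
  next
    case 2
    then show ?thesis by (auto simp: tcheb_elts_def poset_rank_def)
  qed
qed

lemma tcheb_path_rank:
  assumes "(s, t) \<in> (tcheb_cover P)\<^sup>*"
  shows "s = t \<or> tcheb_rank P s < tcheb_rank P t"
  using assms
proof induction
  case (step t u)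
  then show ?case using tcheb_cover_rank [of t u] by auto
qed simp

lemma P_cover_below:
  assumes "(x, y) \<in> gp_le P" "x \<noteq> y"
  shows "\<exists>z. (x, z) \<in> gp_le P \<and> covers (gp_le P) z y"
proof -
  let ?S = "{z. (x, z) \<in> gp_le P \<and> (z, y) \<in> gp_le P \<and> z \<noteq> y}"
  let ?below = "\<lambda>z. {v. (v, z) \<in> gp_le P}"
  have fin: "finite (?below z)" for z
    using P_finite P_sub by (metis (no_types, lifting) finite_subset mem_Collect_eq subsetI)
  have "finite ?S"
    using fin [of y] by (rule rev_finite_subset) auto
  moreover have "x \<in> ?S"
    using assms P_refl P_sub by blast
  ultimately obtain z where z: "z \<in> ?S" and
      max: "\<And>v. v \<in> ?S \<Longrightarrow> card (?below v) \<le> card (?below z)"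
    using Max_in [of "(card \<circ> ?below) ` ?S"] Max_ge [of "(card \<circ> ?below) ` ?S"]
    by (smt (verit, ccfv_SIG) comp_apply empty_iff finite_imageI imageE image_eqI image_is_empty)
  have "covers (gp_le P) z y"
    unfolding covers_def
  proof (intro conjI notI)
    assume "\<exists>v. v \<noteq> z \<and> v \<noteq> y \<and> (z, v) \<in> gp_le P \<and> (v, y) \<in> gp_le P"
    then obtain v where v: "v \<noteq> z" "v \<noteq> y" "(z, v) \<in> gp_le P" "(v, y) \<in> gp_le P"
      by blast
    have "?below z \<subset> ?below v"
      using v P_trans P_antisym P_refl P_sub by blast
    then have "card (?below z) < card (?below v)"
      by (rule psubset_card_mono [OF fin])
    moreover have "v \<in> ?S"
      using v z P_trans by blast
    ultimately show False
      using max by fastforce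
  qed (use z in auto)
  then show ?thesis
    using z by blast
qed

lemma P_rank_mono: "(x, y) \<in> gp_le P \<Longrightarrow> x \<noteq> y \<Longrightarrow> gp_rank P x < gp_rank P y"
proof (induction "card {v. (v, y) \<in> gp_le P}" arbitrary: y rule: less_induct)
  case less
  obtain z where z: "(x, z) \<in> gp_le P" "covers (gp_le P) z y"
    using P_cover_below less.prems by blast
  have zy: "(z, y) \<in> gp_le P" "z \<noteq> y"
    using z by (auto simp: covers_def)
  have "finite {v. (v, y) \<in> gp_le P}"
    using P_finite P_sub by (metis (no_types, lifting) finite_subset mem_Collect_eq subsetI)
  moreover have "{v. (v, z) \<in> gp_le P} \<subset> {v. (v, y) \<in> gp_le P}"
    using zy P_trans P_antisym P_refl P_sub by blast
  ultimately have "card {v. (v, z) \<in> gp_le P} < card {v. (v, y) \<in> gp_le P}"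
    by (rule psubset_card_mono)
  then show ?case
    using less.hyps [of z] z P_rank_cover [of z y] by fastforce
qed

lemma tcheb_path_up:
  assumes "(y, z) \<in> gp_le P" "Ivl x (Old y) \<in> tcheb_elts P"
  shows "(Ivl x (Old y), Ivl x (Old z)) \<in> (tcheb_cover P)\<^sup>*"
  using assms(1)
proof (induction "gp_rank P z" arbitrary: z rule: less_induct)
  case less
  show ?case
  proof (cases "y = z")
    case False
    then obtain v where v: "(y, v) \<in> gp_le P" "covers (gp_le P) v z"
      using P_cover_below less.prems by blast
    then have IH: "(Ivl x (Old y), Ivl x (Old v)) \<in> (tcheb_cover P)\<^sup>*"
      using less.hyps [of v] P_rank_cover by auto
    have "Ivl x (Old v) \<in> tcheb_elts P"
      using IH assms(2) by (metis rtranclE tcheb_cover_rank)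
    then have "(Ivl x (Old v), Ivl x (Old z)) \<in> tcheb_cover P"
      using v adj_covers_Old unfolding tcheb_cover_def by blast
    with IH show ?thesis by simp
  qed simp
qed

lemma MinusOne_elt: "y \<in> gp_elts P \<Longrightarrow> Ivl MinusOne (Old y) \<in> tcheb_elts P"
  by (auto simp: tcheb_elts_def adj_le_def)

lemma tcheb_bot_le:
  assumes "s \<in> tcheb_elts P"
  shows "(Ivl MinusOne (Old (gp_bot P)), s) \<in> (tcheb_cover P)\<^sup>*"
proof -
  have up: "(Ivl MinusOne (Old (gp_bot P)), Ivl MinusOne (Old y)) \<in> (tcheb_cover P)\<^sup>*"
    if "y \<in> gp_elts P" for y
    using tcheb_path_up [of "gp_bot P" y MinusOne] P_bot that MinusOne_elt
    by (auto simp: is_bot_def)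
  show ?thesis
    using assms
  proof (cases rule: tcheb_elts_cases)
    case 1
    have "gp_top P \<in> gp_elts P"
      using P_top by (simp add: is_top_def)
    then have "(Ivl MinusOne (Old (gp_top P)), TTop) \<in> tcheb_cover P"
      unfolding tcheb_cover_def using MinusOne_elt by blast
    then show ?thesis
      using up [OF \<open>gp_top P \<in> gp_elts P\<close>] 1 by simp
  next
    case (2 x y)
    show ?thesis
    proof (cases x)
      case MinusOne
      then show ?thesis using up 2 by simp
    next
      case (Old x')
      have xy: "(x', y) \<in> gp_le P" "x' \<noteq> y"
        using 2 Old by (auto simp: adj_le_def)
      \<comment> \<open>go up to \<open>[-1, x']\<close>, move to \<open>[x', z]\<close> for a cover \<open>z\<close> of \<open>x'\<close>, then up to \<open>[x', y]\<close>\<close>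
      obtain z where z: "covers (gp_le P) x' z" "(z, y) \<in> gp_le P"
      proof -
        let ?S = "{z. (x', z) \<in> gp_le P \<and> x' \<noteq> z \<and> (z, y) \<in> gp_le P}"
        have "y \<in> ?S"
          using xy P_refl P_sub by blast
        then obtain z where z: "z \<in> ?S"
            and min: "\<And>v. v \<in> ?S \<Longrightarrow> gp_rank P z \<le> gp_rank P v"
          using ex_has_least_nat [of "\<lambda>v. v \<in> ?S" y "gp_rank P"] by blast
        have "covers (gp_le P) x' z"
          unfolding covers_def
        proof (intro conjI notI)
          assume "\<exists>v. v \<noteq> x' \<and> v \<noteq> z \<and> (x', v) \<in> gp_le P \<and> (v, z) \<in> gp_le P"
          then obtain v where v: "v \<noteq> x'" "v \<noteq> z" "(x', v) \<in> gp_le P" "(v, z) \<in> gp_le P"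
            by blast
          then have "v \<in> ?S"
            using z P_trans by blast
          with min have "gp_rank P z \<le> gp_rank P v" .
          then show False
            using P_rank_mono [OF v(4,2)] by simp
        qed (use z in auto)
        then show thesis
          using that z by blast
      qed
      have x'_elt: "x' \<in> gp_elts P"
        using xy P_sub by blast
      then have step: "(Ivl MinusOne (Old x'), Ivl (Old x') (Old z)) \<in> tcheb_cover P"
        unfolding tcheb_cover_def using MinusOne_elt z adj_covers_Old by blast
      moreover have "(Ivl (Old x') (Old z), s) \<in> (tcheb_cover P)\<^sup>*"
        using tcheb_path_up [OF z(2)] tcheb_cover_rank [OF step] 2 Old by blast
      ultimately show ?thesis
        using up [OF x'_elt] by (meson rtrancl.rtrancl_into_rtrancl rtrancl_trans)
    qed
  qed
qed

lemma tcheb_le_top: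
  assumes "s \<in> tcheb_elts P"
  shows "(s, TTop) \<in> (tcheb_cover P)\<^sup>*"
  using assms
proof (cases rule: tcheb_elts_cases)
  case (2 x y)
  have up: "(s, Ivl x (Old (gp_top P))) \<in> (tcheb_cover P)\<^sup>*"
    using tcheb_path_up [of y "gp_top P" x] assms 2 P_top by (auto simp: is_top_def)
  then have "Ivl x (Old (gp_top P)) \<in> tcheb_elts P"
    using assms by (metis rtranclE tcheb_cover_rank)
  then have "(Ivl x (Old (gp_top P)), TTop) \<in> tcheb_cover P"
    unfolding tcheb_cover_def by blast
  with up show ?thesis by simp
qed simp

lemma tchebyshev_order: "partial_order_on (gp_elts (tchebyshev P)) (gp_le (tchebyshev P))"
  unfolding partial_order_on_def preorder_on_def refl_on_def
proof (intro conjI)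
  show "trans (gp_le (tchebyshev P))"
    unfolding tchebyshev_def trans_def by (auto intro: rtrancl_trans)
  show "antisym (gp_le (tchebyshev P))"
  proof (rule antisymI)
    fix s t
    assume "(s, t) \<in> gp_le (tchebyshev P)" "(t, s) \<in> gp_le (tchebyshev P)"
    then have st: "(s, t) \<in> (tcheb_cover P)\<^sup>*" and ts: "(t, s) \<in> (tcheb_cover P)\<^sup>*"
      by (auto simp: tchebyshev_def)
    show "s = t"
      using tcheb_path_rank [OF st] tcheb_path_rank [OF ts] by auto
  qed
qed (auto simp: tchebyshev_def)

lemma tchebyshev_is_bot: "is_bot (tchebyshev P) (Ivl MinusOne (Old (gp_bot P)))"
  unfolding is_bot_def tchebyshev_def
  using tcheb_bot_le MinusOne_elt P_bot by (auto simp: is_bot_def)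

lemma tchebyshev_is_top: "is_top (tchebyshev P) TTop"
  unfolding is_top_def tchebyshev_def using tcheb_le_top by (auto simp: tcheb_elts_def)

lemma tchebyshev_covers: "covers (gp_le (tchebyshev P)) s t \<longleftrightarrow> (s, t) \<in> tcheb_cover P"
proof
  assume c: "covers (gp_le (tchebyshev P)) s t"
  then have st: "s \<noteq> t" "(s, t) \<in> (tcheb_cover P)\<^sup>*" "t \<in> tcheb_elts P"
    by (auto simp: covers_def tchebyshev_def)
  then obtain v where v: "(s, v) \<in> tcheb_cover P" "(v, t) \<in> (tcheb_cover P)\<^sup>*"
    by (metis converse_rtranclE)
  have "v = t"
  proof (rule ccontr)
    assume "v \<noteq> t"
    moreover have "v \<noteq> s"
      using tcheb_cover_rank [OF v(1)] by auto
    moreover have "(s, v) \<in> gp_le (tchebyshev P)" "(v, t) \<in> gp_le (tchebyshev P)"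
      using v st tcheb_cover_rank [OF v(1)] by (auto simp: tchebyshev_def)
    ultimately show False
      using c unfolding covers_def by blast
  qed
  with v show "(s, t) \<in> tcheb_cover P" by simp
next
  assume st: "(s, t) \<in> tcheb_cover P"
  note r = tcheb_cover_rank [OF st]
  have "\<not> ((s, z) \<in> (tcheb_cover P)\<^sup>* \<and> (z, t) \<in> (tcheb_cover P)\<^sup>*)" if "z \<noteq> s" "z \<noteq> t" for z
    using that r tcheb_path_rank [of s z] tcheb_path_rank [of z t] by fastforce
  then show "covers (gp_le (tchebyshev P)) s t"
    using st r unfolding covers_def tchebyshev_def by auto
qed

lemma graded_poset_tchebyshev: "graded_poset (tchebyshev P)"
  unfolding graded_poset_def
proof (intro conjI allI impI)
  have "finite (insert MinusOne (Old ` gp_elts P))" (is "finite ?A")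
    using P_finite by simp
  moreover have "adj_le P \<subseteq> ?A \<times> ?A"
    using P_sub by (auto simp: adj_le_def)
  ultimately have "finite (adj_le P)"
    by (meson finite_SigmaI finite_subset)
  moreover have "tcheb_elts P \<subseteq> insert TTop (case_prod Ivl ` adj_le P)"
    by (auto simp: tcheb_elts_def)
  ultimately have "finite (tcheb_elts P)"
    using finite_subset by blast
  then show "finite (gp_elts (tchebyshev P))"
    by (simp add: tchebyshev_def)
  show "gp_rank (tchebyshev P) (gp_bot (tchebyshev P)) = 0"
    by (simp add: gp_bot_eq [OF tchebyshev_order tchebyshev_is_bot] P_rank_bot)
       (simp add: tchebyshev_def P_rank_bot)
  show "gp_rank (tchebyshev P) t = Suc (gp_rank (tchebyshev P) s)"
    if "covers (gp_le (tchebyshev P)) s t" for s t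
    using that tcheb_cover_rank unfolding tchebyshev_covers by (simp add: tchebyshev_def)
qed (use tchebyshev_order tchebyshev_is_bot tchebyshev_is_top in blast)+

lemma poset_rank_tchebyshev: "poset_rank (tchebyshev P) = poset_rank P + 1"
  by (simp add: poset_rank_def [of "tchebyshev P"] gp_top_eq [OF tchebyshev_order tchebyshev_is_top])
     (simp add: tchebyshev_def)

end

end

theory Submission
  imports Defs "HOL.Modules"
begin

text \<open>
  Write $e = a - b$ and $n = \rho(P)$. A chain of $T(P)$ from $[\widehat{-1}, \widehat 0]$ to the
  new maximum projects, by taking right endpoints, to a chain
  $\widehat 0 = y_0 < y_1 < \cdots < y_m \le \widehat 1$ of $P$, and the ranks occurring in its
  weight depend on the $y_i$ only. Above a fixed interval $[x, y_{i-1}]$ the intervals with right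
  endpoint $y_i$ are $[x, y_i]$ and the $[z, y_i]$ with $y_{i-1} \le z < y_i$; their number is the
  cardinality $N(y_{i-1}, y_i)$ of the closed interval of $P$ between $y_{i-1}$ and $y_i$, whatever
  $x$ is. So $\Psi(T(P)) = H(\widehat 0)$, where $H$ is the function on $P$ with
    $$H(x) = e^{n - \rho(x)} + \sum_{y > x} N(x, y)\, e^{\rho(x,y) - 1}\, b\, H(y).$$
  On the other side, $\Psi(P)\,a$ is the $ab$-index of $P$ with a further maximum adjoined. Let
  $F(x)$ be the $ab$-index of the part above $x$ of that larger poset
  (\<open>capped_index\<close>, \<open>capped_index_rec\<close>); then
    $$F(x) = e^{n - \rho(x)} + \sum_{y > x} e^{\rho(x,y) - 1}\, b\, F(y).$$

  It remains to see that the operator $T$ turns the second recursion into the first. Since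
  $\Delta(e) = 0$ and $\Delta(b) = 1 \otimes 1$, the operator $T$ is easy to evaluate on products of
  $e$ and $b$: together with the companion $K(u) = \sum \kappa(u_{(1)})\, b\, T(u_{(2)})$
  (\<open>kappa_cut\<close>) it satisfies
    $$T(1) = 1,\quad T(eu) = e\,T(u),\quad T(bu) = 2b\,T(u) + e\,K(u),$$
    $$K(1) = 0,\quad K(eu) = e\,K(u),\quad K(bu) = b\,T(u).$$
  These rules give $K(F(x)) = \sum_{y > x} e^{\rho(x,y) - 1}\, b\, T(F(y))$ at once. Then the term
  $2b\,T$ in $T(bu)$ counts, for each $y > x$, the two ends of the interval from $x$ to $y$, and
  the term $e\,K$ counts its interior points, so $T(F(x))$ satisfies the recursion of $H$
  (\<open>tcheb_op_capped_index\<close>). Hence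
  $T(F(x)) = H(x)$, and $x = \widehat 0$ is the claim; the equality with the $ab$-index of $T(P)$
  above $[z, x]$, for any $z$, is \<open>upper_index_tchebyshev\<close>.
\<close>

section \<open>Linearity\<close>

abbreviation var_e :: ab_poly where "var_e \<equiv> var_a - var_b"

text \<open>
  Induction over free abelian groups uses differences, so linearity is available as compatibility
  with them.
\<close>

lemma additive_if_diff:
  fixes f :: "'b::ab_group_add \<Rightarrow> 'c::ab_group_add"
  assumes diff: "\<And>u v. f (u - v) = f u - f v"
  shows "additive f"
proof
  fix u v
  have "f 0 = 0"
    using diff [of 0 0] by simp
  moreover have "f (u - (0 - v)) = f u - (f 0 - f v)"
    by (simp only: diff)
  ultimately show "f (u + v) = f u + f v"
    by simp
qed

lemma frag_cmul_eq_of_int_mult: "frag_cmul c u = of_int c * (u :: 'a::monoid_add \<Rightarrow>\<^sub>0 int)"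
proof (induction c)
  case (nonneg n)
  then show ?case
    by (induction n) (simp_all add: frag_cmul_distrib distrib_right)
next
  case (neg n)
  have "frag_cmul (int m) u = of_nat m * u" for m
    by (induction m) (simp_all add: frag_cmul_distrib distrib_right)
  then show ?case
    by (metis minus_frag_cmul mult_minus_left of_int_minus of_int_of_nat_eq)
qed

lemma frag_extend_mult_left:
  fixes m :: "'a::monoid_add \<Rightarrow>\<^sub>0 int"
  shows "frag_extend (\<lambda>x. m * f x) c = m * frag_extend f c"
  by (induction c rule: frag_induct) (simp_all add: frag_extend_diff right_diff_distrib)

section \<open>The functionals and the coefficient operators on words\<close>

lemma A_op_words:
  "A_op (frag_of []) = 1" "A_op (frag_of (La # w)) = A_op (frag_of w)" "A_op (frag_of (Lb # w)) = 0"
  by (simp_all add: A_op_def)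

lemma C_op_word:
  "C_op (frag_of w) = 2 * A_op (frag_of w) +
     (\<Sum>i<length w. A_op (frag_of (take i w)) * A_op (frag_of (drop (Suc i) w)))"
proof -
  interpret additive "int_extend (\<lambda>(v, w). A_op (frag_of v) * A_op (frag_of w))"
    by (rule additive_if_diff) (rule int_extend_diff)
  show ?thesis
    by (simp add: C_op_def coprod_def sum)
qed

text \<open>
  Splitting a word at its first letter gives one tensor with left factor 1; all others keep the
  letter in the left factor, where \<open>A\<close> deletes an \<open>a\<close> and annihilates a \<open>b\<close>.
\<close>

lemma C_op_words:
  "C_op (frag_of []) = 2"
  "C_op (frag_of (La # w)) = C_op (frag_of w) + A_op (frag_of w)"
  "C_op (frag_of (Lb # w)) = A_op (frag_of w)"
  by (simp_all add: C_op_word A_op_words sum.lessThan_Suc_shift del: sum.lessThan_Suc)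

text \<open>
  In terms of \<open>e\<close>, these rules and the next ones say that \<open>\<kappa>\<close> and \<open>\<nu>\<close> commute with left
  multiplication by \<open>e\<close>, and that left multiplication by \<open>b\<close> kills \<open>\<kappa>\<close> and turns \<open>\<nu>\<close>
  into \<open>e \<kappa>\<close>.
\<close>

lemma kappa_words:
  "kappa (frag_of []) = 1"
  "kappa (frag_of (La # w)) = var_e * kappa (frag_of w)"
  "kappa (frag_of (Lb # w)) = 0"
  by (simp_all add: kappa_def A_op_words frag_cmul_eq_of_int_mult mult.assoc)
    (metis mult.assoc mult_of_int_commute)

lemma nu_words:
  "nu (frag_of []) = 2"
  "nu (frag_of (La # w)) = var_e * (nu (frag_of w) + kappa (frag_of w))"
  "nu (frag_of (Lb # w)) = var_e * kappa (frag_of w)"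
  by (simp_all add: nu_def kappa_def C_op_words frag_cmul_eq_of_int_mult algebra_simps
      mult_of_int_commute)

section \<open>A recursion for the Tchebyshev operator\<close>

lemma coprod_iter_word:
  "coprod_iter (Suc (Suc k)) (frag_of w) = (\<Sum>i<length w.
     frag_extend (\<lambda>ws. frag_of (take i w # ws)) (coprod_iter (Suc k) (frag_of (drop (Suc i) w))))"
  by (simp add: coprod_def frag_extend_sum o_def)

text \<open>
  The value of \<^const>\<open>tcheb_tensor\<close> on \<open>v # ws\<close> factors through its value on \<open>ws\<close> only for
  nonempty \<open>ws\<close>.
\<close>

lemma Nil_notin_keys_coprod_iter: "[] \<notin> Poly_Mapping.keys (coprod_iter k u)"
proof (cases "(k, u)" rule: coprod_iter.cases)
  case (3 k' u')
  have "[] \<notin> Poly_Mapping.keys (frag_extend (\<lambda>ws. frag_of (v # ws)) c)" for v :: word and c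
    using keys_frag_extend [of "\<lambda>ws. frag_of (v # ws)" c] by (auto simp: keys_frag_of)
  then show ?thesis
    using 3 keys_frag_extend by (fastforce split: prod.splits)
qed (use keys_frag_extend [of "\<lambda>w. frag_of [w]" u] in \<open>auto simp: keys_frag_of\<close>)

lemma frag_extend_tcheb_tensor_Cons:
  "frag_extend tcheb_tensor (frag_extend (\<lambda>ws. frag_of (v # ws)) (coprod_iter k u)) =
     nu (frag_of v) * var_b * frag_extend tcheb_tensor (coprod_iter k u)"
proof -
  have "frag_extend tcheb_tensor (frag_extend (\<lambda>ws. frag_of (v # ws)) (coprod_iter k u)) =
      frag_extend (\<lambda>ws. tcheb_tensor (v # ws)) (coprod_iter k u)"
    using frag_extend_compose [of tcheb_tensor "(#) v"] by (simp add: o_def)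
  also have "\<dots> = frag_extend (\<lambda>ws. nu (frag_of v) * var_b * tcheb_tensor ws) (coprod_iter k u)"
  proof (rule frag_extend_eq)
    fix ws assume "ws \<in> Poly_Mapping.keys (coprod_iter k u)"
    then have "ws \<noteq> []" using Nil_notin_keys_coprod_iter by metis
    then show "tcheb_tensor (v # ws) = nu (frag_of v) * var_b * tcheb_tensor ws"
      by (cases ws) simp_all
  qed
  finally show ?thesis by (simp add: frag_extend_mult_left)
qed

lemma additive_tcheb_op: "additive tcheb_op"
proof (rule additive_if_diff)
  fix u v :: ab_poly
  let ?g = "\<lambda>u k. frag_extend tcheb_tensor (coprod_iter (Suc k) u)"
  have "tcheb_op (u - v) + tcheb_op v = Sum_any (\<lambda>k. ?g (u - v) k + ?g v k)"
    unfolding tcheb_op_def by (rule Sum_any.distrib [symmetric]) (rule finite_tcheb_support)+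
  also have "\<dots> = tcheb_op u"
    unfolding tcheb_op_def coprod_iter_diff frag_extend_diff by simp
  finally show "tcheb_op (u - v) = tcheb_op u - tcheb_op v"
    by (simp add: algebra_simps)
qed

interpretation tcheb_op: additive tcheb_op by (rule additive_tcheb_op)

lemma tcheb_op_word_bounded:
  assumes "length w \<le> n"
  shows "tcheb_op (frag_of w) =
    (\<Sum>k\<le>n. frag_extend tcheb_tensor (coprod_iter (Suc k) (frag_of w)))"
  unfolding tcheb_op_def
proof (rule Sum_any.expand_superset)
  show "{k. frag_extend tcheb_tensor (coprod_iter (Suc k) (frag_of w)) \<noteq> 0} \<subseteq> {..n}"
  proof
    fix k assume "k \<in> {k. frag_extend tcheb_tensor (coprod_iter (Suc k) (frag_of w)) \<noteq> 0}"
    then have "\<not> length w < k"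
      using coprod_iter_eq_0 [of w k] by (metis (mono_tags) frag_extend_0 mem_Collect_eq)
    then show "k \<in> {..n}" using assms by simp
  qed
qed simp

text \<open>
  The tensors in $k + 1$ parts arise by cutting off a first part and splitting
  the rest into $k$ parts. Summing over all $k$ gives
  $T(u) = \kappa(u) + \sum \nu(u_{(1)})\, b\, T(u_{(2)})$.
\<close>

lemma tcheb_op_word:
  "tcheb_op (frag_of w) = kappa (frag_of w) +
     (\<Sum>i<length w. nu (frag_of (take i w)) * var_b * tcheb_op (frag_of (drop (Suc i) w)))"
proof -
  let ?E = "\<lambda>k w. frag_extend tcheb_tensor (coprod_iter (Suc k) (frag_of w))"
  have "tcheb_op (frag_of w) = (\<Sum>k\<le>Suc (length w). ?E k w)"
    by (rule tcheb_op_word_bounded) simp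
  also have "\<dots> = ?E 0 w + (\<Sum>k\<le>length w. ?E (Suc k) w)"
    by (rule sum.atMost_Suc_shift)
  also have "?E 0 w = kappa (frag_of w)"
    by simp
  also have "(\<Sum>k\<le>length w. ?E (Suc k) w) = (\<Sum>k\<le>length w. \<Sum>i<length w.
      nu (frag_of (take i w)) * var_b * ?E k (drop (Suc i) w))"
    by (simp only: coprod_iter_word frag_extend_sum finite_lessThan o_def
        frag_extend_tcheb_tensor_Cons)
  also have "\<dots> = (\<Sum>i<length w. nu (frag_of (take i w)) * var_b *
      (\<Sum>k\<le>length w. ?E k (drop (Suc i) w)))"
    unfolding sum_distrib_left by (rule sum.swap)
  also have "\<dots> = (\<Sum>i<length w. nu (frag_of (take i w)) * var_b * tcheb_op (frag_of (drop (Suc i) w)))"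
    by (rule sum.cong [OF refl]) (subst tcheb_op_word_bounded [of _ "length w"], simp_all)
  finally show ?thesis .
qed

text \<open>
  In the recursion for \<^const>\<open>tcheb_op\<close> the operator \<open>\<nu>\<close> is applied to the first part, and
  prefixing \<open>b\<close> to the argument turns \<open>\<nu>\<close> into \<open>e \<kappa>\<close>. Hence the same sum with \<open>\<kappa>\<close> in place
  of \<open>\<nu>\<close>, which is this operator, is needed to express \<open>T (b u)\<close>.
\<close>

definition kappa_cut :: "ab_poly \<Rightarrow> ab_poly" where
  "kappa_cut = frag_extend (\<lambda>w. \<Sum>i<length w.
     kappa (frag_of (take i w)) * var_b * tcheb_op (frag_of (drop (Suc i) w)))"

interpretation kappa_cut: additive kappa_cut
  by (rule additive_if_diff) (simp add: kappa_cut_def frag_extend_diff)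

lemma kappa_cut_words:
  "kappa_cut (frag_of []) = 0"
  "kappa_cut (frag_of (La # w)) = var_b * tcheb_op (frag_of w) + var_e * kappa_cut (frag_of w)"
  "kappa_cut (frag_of (Lb # w)) = var_b * tcheb_op (frag_of w)"
  by (simp_all add: kappa_cut_def kappa_words sum.lessThan_Suc_shift sum_distrib_left mult.assoc
      del: sum.lessThan_Suc)

lemma tcheb_op_words:
  "tcheb_op (frag_of []) = 1"
  "tcheb_op (frag_of (La # w)) =
     2 * var_b * tcheb_op (frag_of w) + var_e * tcheb_op (frag_of w) + var_e * kappa_cut (frag_of w)"
  "tcheb_op (frag_of (Lb # w)) = 2 * var_b * tcheb_op (frag_of w) + var_e * kappa_cut (frag_of w)"
proof -
  show "tcheb_op (frag_of []) = 1"
    by (subst tcheb_op_word) (simp add: kappa_words)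
  (* Prefixing a letter to w prefixes it to every left factor and adds the tensor of 1 and w,
     which contributes nu 1 = 2. *)
  define S where "S f = (\<Sum>i<length w. f (frag_of (take i w)) * var_b *
    tcheb_op (frag_of (drop (Suc i) w)))" for f :: "ab_poly \<Rightarrow> ab_poly"
  have K: "kappa_cut (frag_of w) = S kappa"
    by (simp add: kappa_cut_def S_def)
  have T: "tcheb_op (frag_of w) = kappa (frag_of w) + S nu"
    unfolding S_def by (rule tcheb_op_word)
  have T_Cons: "tcheb_op (frag_of (l # w)) =
      kappa (frag_of (l # w)) + 2 * var_b * tcheb_op (frag_of w) + S (\<lambda>u. nu (frag_of [l] * u))" for l
    by (subst tcheb_op_word) (simp add: S_def nu_words frag_of_mult sum.lessThan_Suc_shift
        add.assoc del: sum.lessThan_Suc)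
  have "S (\<lambda>u. nu (frag_of [Lb] * u)) = var_e * S kappa"
    by (simp add: S_def frag_of_mult nu_words sum_distrib_left mult.assoc)
  then show "tcheb_op (frag_of (Lb # w)) = 2 * var_b * tcheb_op (frag_of w) + var_e * kappa_cut (frag_of w)"
    by (simp add: T_Cons K kappa_words)
  have "S (\<lambda>u. nu (frag_of [La] * u)) = var_e * S nu + var_e * S kappa"
    by (simp only: S_def frag_of_mult nu_words sum_distrib_left mult.assoc distrib_left
        distrib_right sum.distrib append.simps)
  then show "tcheb_op (frag_of (La # w)) =
     2 * var_b * tcheb_op (frag_of w) + var_e * tcheb_op (frag_of w) + var_e * kappa_cut (frag_of w)"
    by (simp add: T_Cons K kappa_words) (simp add: T distrib_left)
qed

lemma mult_var_frag_of:
  "var_a * frag_of w = frag_of (La # w)" "var_b * frag_of w = frag_of (Lb # w)"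
  by (simp_all add: var_a_def var_b_def frag_of_mult)

text \<open>
  Subtracting the rule for \<open>b\<close> from the one for \<open>a\<close>, here and for \<^const>\<open>tcheb_op\<close>, leaves
  commutation with \<open>e\<close>.
\<close>

lemma kappa_cut_var:
  "kappa_cut (var_a * u) = var_b * tcheb_op u + var_e * kappa_cut u"
  "kappa_cut (var_b * u) = var_b * tcheb_op u"
proof -
  show "kappa_cut (var_a * u) = var_b * tcheb_op u + var_e * kappa_cut u"
  proof (induction u rule: frag_induct)
    case (diff u v)
    show ?case
      by (simp only: right_diff_distrib kappa_cut.diff tcheb_op.diff diff) (simp add: algebra_simps)
  qed (simp_all add: kappa_cut.zero tcheb_op.zero mult_var_frag_of kappa_cut_words)
  show "kappa_cut (var_b * u) = var_b * tcheb_op u"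
  proof (induction u rule: frag_induct)
    case (diff u v)
    show ?case
      by (simp only: right_diff_distrib kappa_cut.diff tcheb_op.diff diff)
  qed (simp_all add: kappa_cut.zero tcheb_op.zero mult_var_frag_of kappa_cut_words)
qed

lemma tcheb_op_var:
  "tcheb_op (var_a * u) = 2 * var_b * tcheb_op u + var_e * tcheb_op u + var_e * kappa_cut u"
  "tcheb_op (var_b * u) = 2 * var_b * tcheb_op u + var_e * kappa_cut u"
proof -
  show "tcheb_op (var_a * u) = 2 * var_b * tcheb_op u + var_e * tcheb_op u + var_e * kappa_cut u"
  proof (induction u rule: frag_induct)
    case (diff u v)
    show ?case
      by (simp only: right_diff_distrib kappa_cut.diff tcheb_op.diff diff) (simp add: algebra_simps)
  qed (simp_all add: kappa_cut.zero tcheb_op.zero mult_var_frag_of tcheb_op_words)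
  show "tcheb_op (var_b * u) = 2 * var_b * tcheb_op u + var_e * kappa_cut u"
  proof (induction u rule: frag_induct)
    case (diff u v)
    show ?case
      by (simp only: right_diff_distrib kappa_cut.diff tcheb_op.diff diff) (simp add: algebra_simps)
  qed (simp_all add: kappa_cut.zero tcheb_op.zero mult_var_frag_of tcheb_op_words)
qed

lemma kappa_cut_e_power:
  "kappa_cut (var_e ^ n) = 0" "kappa_cut (var_e ^ n * u) = var_e ^ n * kappa_cut u"
proof -
  have e: "kappa_cut (var_e * u) = var_e * kappa_cut u" for u
  proof -
    have "kappa_cut (var_e * u) = kappa_cut (var_a * u) - kappa_cut (var_b * u)"
      by (simp only: left_diff_distrib kappa_cut.diff)
    then show ?thesis by (simp add: kappa_cut_var)
  qed
  show power: "kappa_cut (var_e ^ n * u) = var_e ^ n * kappa_cut u" for u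
    by (induction n) (simp_all add: e mult.assoc)
  show "kappa_cut (var_e ^ n) = 0"
    using power [of 1] kappa_cut_words(1) by (simp flip: one_eq_frag_of)
qed

lemma tcheb_op_e_power:
  "tcheb_op (var_e ^ n) = var_e ^ n" "tcheb_op (var_e ^ n * u) = var_e ^ n * tcheb_op u"
proof -
  have e: "tcheb_op (var_e * u) = var_e * tcheb_op u" for u
  proof -
    have "tcheb_op (var_e * u) = tcheb_op (var_a * u) - tcheb_op (var_b * u)"
      by (simp only: left_diff_distrib tcheb_op.diff)
    then show ?thesis by (simp add: tcheb_op_var)
  qed
  show power: "tcheb_op (var_e ^ n * u) = var_e ^ n * tcheb_op u" for u
    by (induction n) (simp_all add: e mult.assoc)
  show "tcheb_op (var_e ^ n) = var_e ^ n"
    using power [of 1] tcheb_op_words(1) by (simp flip: one_eq_frag_of)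
qed

section \<open>The ab-index of upper intervals\<close>

definition strictly_above :: "'a gposet \<Rightarrow> 'a \<Rightarrow> 'a set" where
  "strictly_above Q x = {y. (x, y) \<in> gp_le Q \<and> x \<noteq> y}"

definition upper_chains :: "'a gposet \<Rightarrow> 'a \<Rightarrow> 'a list set" where
  "upper_chains Q x = {c. c \<noteq> [] \<and> set c \<subseteq> gp_elts Q \<and> hd c = x \<and> last c = gp_top Q \<and>
     sorted_wrt (\<lambda>x y. (x, y) \<in> gp_le Q \<and> x \<noteq> y) c}"

text \<open>
  The only chain at the maximum is a singleton, of weight 0, so this vanishes there; the recursion
  below therefore separates the maximum from the other elements.
\<close>

definition upper_index :: "'a gposet \<Rightarrow> 'a \<Rightarrow> ab_poly" where
  "upper_index Q x = (\<Sum>c\<in>upper_chains Q x. chain_weight (gp_rank Q) c)"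

text \<open>
  The ab-index of the interval from \<open>x\<close> to \<open>1'\<close> in the poset obtained by adjoining a maximum \<open>1'\<close>
  above the old one: a chain through the old maximum contributes a further \<open>b\<close> and a chain avoiding
  it a further \<open>a - b\<close>, which together is multiplication by \<open>a\<close>. If \<open>x\<close> is the old maximum, the
  interval has rank 1 and its only chain has weight 1.
\<close>

definition capped_index :: "'a gposet \<Rightarrow> 'a \<Rightarrow> ab_poly" where
  "capped_index Q x = (if x = gp_top Q then 1 else upper_index Q x * var_a)"

lemma ab_index_eq_upper_index: "ab_index Q = upper_index Q (gp_bot Q)"
  by (simp add: ab_index_def upper_index_def chains_def upper_chains_def)

context
  fixes P :: "'a gposet"
  assumes P: "graded_poset P"
begin

lemma finite_strictly_above: "finite (strictly_above P x)"
  by (rule finite_subset [OF _ P_finite [OF P]]) (use P_sub [OF P] in \<open>auto simp: strictly_above_def\<close>)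

lemma finite_upper_chains: "finite (upper_chains P x)"
proof -
  have "distinct c" if "sorted_wrt (\<lambda>x y. (x, y) \<in> gp_le P \<and> x \<noteq> y) c" for c
    using that by (induction c) auto
  then have "upper_chains P x \<subseteq> {c. set c \<subseteq> gp_elts P \<and> distinct c}"
    by (auto simp: upper_chains_def)
  then show ?thesis
    using P_finite [OF P] finite_subset_distinct finite_subset by blast
qed

lemma top_elt: "gp_top P \<in> gp_elts P"
  and le_top: "x \<in> gp_elts P \<Longrightarrow> (x, gp_top P) \<in> gp_le P"
  using P_top [OF P] by (auto simp: is_top_def)

lemma strictly_above_top: "strictly_above P (gp_top P) = {}"
  using P_antisym [OF P] P_sub [OF P] le_top by (fastforce simp: strictly_above_def)

lemma upper_chains_top: "upper_chains P (gp_top P) = {[gp_top P]}"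
proof -
  have "c = [gp_top P]" if "c \<in> upper_chains P (gp_top P)" for c
  proof (cases c rule: list.exhaust)
    case (Cons y c')
    then have "y = gp_top P" "\<And>z. z \<in> set c' \<Longrightarrow> z \<in> strictly_above P (gp_top P)"
      using that by (auto simp: upper_chains_def strictly_above_def)
    then show ?thesis
      using Cons strictly_above_top by (cases c') auto
  qed (use that in \<open>simp add: upper_chains_def\<close>)
  then show ?thesis
    using top_elt by (auto simp: upper_chains_def)
qed

lemma upper_chains_rec:
  assumes "x \<in> gp_elts P" "x \<noteq> gp_top P"
  shows "upper_chains P x = (\<Union>y\<in>strictly_above P x. (#) x ` upper_chains P y)"
proof (intro equalityI subsetI)
  fix c assume c: "c \<in> upper_chains P x"
  then obtain y c' where "c = x # y # c'"
    using assms(2) by (cases c rule: remdups_adj.cases) (auto simp: upper_chains_def)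
  then show "c \<in> (\<Union>y\<in>strictly_above P x. (#) x ` upper_chains P y)"
    using c by (auto simp: upper_chains_def strictly_above_def)
next
  fix c assume "c \<in> (\<Union>y\<in>strictly_above P x. (#) x ` upper_chains P y)"
  then obtain y c' where y: "(x, y) \<in> gp_le P" "x \<noteq> y" and c: "c = x # c'" "c' \<in> upper_chains P y"
    by (auto simp: strictly_above_def)
  then obtain c'' where c': "c' = y # c''"
    by (cases c') (auto simp: upper_chains_def)
  have "(x, z) \<in> gp_le P \<and> x \<noteq> z" if "z \<in> set c'" for z
  proof -
    have "(y, z) \<in> gp_le P"
      using that c c' P_refl [OF P] by (auto simp: upper_chains_def)
    then show ?thesis
      using y P_trans [OF P] P_antisym [OF P] by blast
  qed
  then show "c \<in> upper_chains P x"
    using c c' assms(1) by (auto simp: upper_chains_def)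
qed

lemma upper_index_rec:
  assumes x: "x \<in> gp_elts P" "x \<noteq> gp_top P"
  shows "upper_index P x = var_e ^ (poset_rank P - gp_rank P x - 1) +
    (\<Sum>y\<in>strictly_above P x - {gp_top P}.
       var_e ^ (gp_rank P y - gp_rank P x - 1) * var_b * upper_index P y)"
proof -
  let ?w = "chain_weight (gp_rank P)"
  let ?S = "\<lambda>y. \<Sum>c\<in>upper_chains P y. ?w (x # c)"
  have "upper_index P x = (\<Sum>y\<in>strictly_above P x. sum ?w ((#) x ` upper_chains P y))"
    unfolding upper_index_def upper_chains_rec [OF x]
    by (rule sum.UNION_disjoint)
      (auto simp: finite_strictly_above finite_upper_chains, auto simp: upper_chains_def)
  also have "\<dots> = sum ?S (strictly_above P x)"
    by (simp add: sum.reindex o_def)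
  also have "\<dots> = ?S (gp_top P) + sum ?S (strictly_above P x - {gp_top P})"
    by (rule sum.remove) (use x le_top finite_strictly_above in \<open>auto simp: strictly_above_def\<close>)
  also have "?S (gp_top P) = var_e ^ (poset_rank P - gp_rank P x - 1)"
    by (simp add: upper_chains_top poset_rank_def)
  also have "sum ?S (strictly_above P x - {gp_top P}) =
      (\<Sum>y\<in>strictly_above P x - {gp_top P}.
         var_e ^ (gp_rank P y - gp_rank P x - 1) * var_b * upper_index P y)"
  proof (rule sum.cong [OF refl])
    fix y assume y: "y \<in> strictly_above P x - {gp_top P}"
    have "?w (x # c) = var_e ^ (gp_rank P y - gp_rank P x - 1) * var_b * ?w c"
      if "c \<in> upper_chains P y" for c
      using that y by (cases c rule: remdups_adj.cases) (auto simp: upper_chains_def)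
    then show "?S y = var_e ^ (gp_rank P y - gp_rank P x - 1) * var_b * upper_index P y"
      by (simp add: upper_index_def sum_distrib_left)
  qed
  finally show ?thesis .
qed

lemma rank_less: "y \<in> strictly_above P x \<Longrightarrow> gp_rank P x < gp_rank P y"
  using P_rank_mono [OF P] by (simp add: strictly_above_def)

lemma rank_top: "x \<in> gp_elts P \<Longrightarrow> x \<noteq> gp_top P \<Longrightarrow> gp_rank P x < poset_rank P"
  using rank_less [of "gp_top P" x] le_top by (simp add: strictly_above_def poset_rank_def)

text \<open>
  The old maximum is an ordinary element here, unlike in \<open>upper_index_rec\<close>. Writing
  \<open>e = a - b\<close> trades the extra factor \<open>e\<close> of the first term against the summand of the old
  maximum.
\<close>

lemma capped_index_rec:
  assumes x: "x \<in> gp_elts P"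
  shows "capped_index P x = var_e ^ (poset_rank P - gp_rank P x) +
    (\<Sum>y\<in>strictly_above P x. var_e ^ (gp_rank P y - gp_rank P x - 1) * var_b * capped_index P y)"
proof (cases "x = gp_top P")
  case True
  then show ?thesis
    by (simp add: capped_index_def strictly_above_top poset_rank_def)
next
  case False
  let ?m = "poset_rank P - gp_rank P x - 1"
  let ?t = "\<lambda>y. var_e ^ (gp_rank P y - gp_rank P x - 1) * var_b * capped_index P y"
  have "sum ?t (strictly_above P x) = ?t (gp_top P) + sum ?t (strictly_above P x - {gp_top P})"
    by (rule sum.remove) (use x False le_top finite_strictly_above in \<open>auto simp: strictly_above_def\<close>)
  moreover have "?t (gp_top P) = var_e ^ ?m * var_b"
    by (simp add: capped_index_def poset_rank_def)
  moreover have "capped_index P x =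
      var_e ^ ?m * var_a + sum ?t (strictly_above P x - {gp_top P})"
    using False by (simp add: capped_index_def upper_index_rec [OF x] distrib_right
        sum_distrib_right mult.assoc)
  moreover have "poset_rank P - gp_rank P x = Suc ?m"
    using rank_top [OF x False] by simp
  then have "var_e ^ (poset_rank P - gp_rank P x) = var_e ^ ?m * var_e"
    by (metis power_Suc2)
  ultimately show ?thesis
    by (simp add: right_diff_distrib)
qed

section \<open>The Tchebyshev operator on upper intervals\<close>

lemma kappa_cut_capped_index:
  assumes x: "x \<in> gp_elts P"
  shows "kappa_cut (capped_index P x) =
    (\<Sum>y\<in>strictly_above P x.
       var_e ^ (gp_rank P y - gp_rank P x - 1) * var_b * tcheb_op (capped_index P y))"
  by (simp add: capped_index_rec [OF x] kappa_cut.add kappa_cut.sum kappa_cut_e_power kappa_cut_var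
      mult.assoc)

text \<open>
  Applied to the summand of \<open>y\<close> in \<open>capped_index_rec\<close>, the rule $T(bu) = 2b\,T(u) + e\,K(u)$ yields
  two copies of the new summand of \<open>y\<close>, and one copy of that of each \<open>z > y\<close>. After interchanging
  the sums, the summand of \<open>z\<close> occurs twice and once more for each \<open>y\<close> strictly between \<open>x\<close> and
  \<open>z\<close>, which is the number of elements of the closed interval.
\<close>

lemma tcheb_op_capped_index:
  assumes x: "x \<in> gp_elts P"
  shows "tcheb_op (capped_index P x) = var_e ^ (poset_rank P - gp_rank P x) +
    (\<Sum>y\<in>strictly_above P x. of_nat (card {z. (x, z) \<in> gp_le P \<and> (z, y) \<in> gp_le P}) *
       (var_e ^ (gp_rank P y - gp_rank P x - 1) * var_b * tcheb_op (capped_index P y)))"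
proof -
  let ?up = "strictly_above P"
  define t where "t y = var_e ^ (gp_rank P y - gp_rank P x - 1) * var_b * tcheb_op (capped_index P y)"
    for y
  have elt: "y \<in> gp_elts P" if "y \<in> ?up x" for y
    using that P_sub [OF P] by (auto simp: strictly_above_def)
  have below: "z \<in> ?up x" if "y \<in> ?up x" "z \<in> ?up y" for y z
    using that P_trans [OF P] P_antisym [OF P] unfolding strictly_above_def by blast
  have summand: "tcheb_op (var_e ^ (gp_rank P y - gp_rank P x - 1) * var_b * capped_index P y) =
      2 * t y + sum t (?up y)" if y: "y \<in> ?up x" for y
  proof -
    let ?m = "gp_rank P y - gp_rank P x - 1"
    have "var_e ^ ?m * (var_e * (var_e ^ (gp_rank P z - gp_rank P y - 1) * var_b * u)) =
        var_e ^ (gp_rank P z - gp_rank P x - 1) * var_b * u" if "z \<in> ?up y" for z u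
    proof -
      have "gp_rank P z - gp_rank P x - 1 = ?m + Suc (gp_rank P z - gp_rank P y - 1)"
        using rank_less [OF y] rank_less [OF that] by simp
      then show ?thesis
        by (simp only: power_add power_Suc mult.assoc)
    qed
    then have "var_e ^ ?m * (var_e * kappa_cut (capped_index P y)) = sum t (?up y)"
      by (simp add: kappa_cut_capped_index [OF elt [OF y]] sum_distrib_left t_def)
    moreover have "var_e ^ ?m * (2 * u) = 2 * (var_e ^ ?m * u)" for u
      by (simp add: distrib_left mult_2)
    ultimately show ?thesis
      by (simp add: mult.assoc tcheb_op_e_power tcheb_op_var distrib_left t_def)
  qed
  have "sum (\<lambda>y. sum t (?up y)) (?up x) = (\<Sum>y\<in>?up x. \<Sum>z | z \<in> ?up x \<and> z \<in> ?up y. t z)"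
    by (intro sum.cong refl arg_cong [of _ _ "sum t"]) (use below in auto)
  also have "\<dots> = (\<Sum>z\<in>?up x. \<Sum>y | y \<in> ?up x \<and> z \<in> ?up y. t z)"
    by (rule sum.swap_restrict) (rule finite_strictly_above)+
  finally have swap: "sum (\<lambda>y. sum t (?up y)) (?up x) =
      (\<Sum>z\<in>?up x. of_nat (card {y \<in> ?up x. z \<in> ?up y}) * t z)"
    by simp
  have card: "card {y. (x, y) \<in> gp_le P \<and> (y, z) \<in> gp_le P} = 2 + card {y \<in> ?up x. z \<in> ?up y}"
    if z: "z \<in> ?up x" for z
  proof -
    have "{y. (x, y) \<in> gp_le P \<and> (y, z) \<in> gp_le P} = insert x (insert z {y \<in> ?up x. z \<in> ?up y})"
      using z P_refl [OF P] P_sub [OF P] by (auto simp: strictly_above_def)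
    moreover have "x \<notin> insert z {y \<in> ?up x. z \<in> ?up y}" "z \<notin> {y \<in> ?up x. z \<in> ?up y}"
      using z by (auto simp: strictly_above_def)
    ultimately show ?thesis
      using finite_strictly_above [of x] by simp
  qed
  have "tcheb_op (capped_index P x) = var_e ^ (poset_rank P - gp_rank P x) +
      (\<Sum>y\<in>?up x. 2 * t y + sum t (?up y))"
    by (simp only: capped_index_rec [OF x] tcheb_op.add tcheb_op.sum tcheb_op_e_power summand
        cong: sum.cong)
  also have "(\<Sum>y\<in>?up x. 2 * t y + sum t (?up y)) =
      (\<Sum>y\<in>?up x. (2 + of_nat (card {z \<in> ?up x. y \<in> ?up z})) * t y)"
    by (simp only: sum.distrib swap distrib_right)
  also have "\<dots> = (\<Sum>y\<in>?up x. of_nat (card {z. (x, z) \<in> gp_le P \<and> (z, y) \<in> gp_le P}) * t y)"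
    by (rule sum.cong) (simp_all only: card of_nat_add of_nat_numeral)
  finally show ?thesis
    unfolding t_def .
qed

section \<open>The order of the Tchebyshev transform\<close>

text \<open>
  Go up to \<open>[x, z]\<close>, switch the left endpoint to \<open>z\<close> in a cover relation, then move the right
  endpoint up to \<open>w\<close>.
\<close>

lemma tchebyshev_leI:
  assumes s: "Ivl x (Old y) \<in> tcheb_elts P" and yz: "(y, z) \<in> gp_le P"
    and zw: "(z, w) \<in> gp_le P" "z \<noteq> w"
  shows "(Ivl x (Old y), Ivl (Old z) (Old w)) \<in> (tcheb_cover P)\<^sup>*"
  using zw
proof (induction "gp_rank P w" arbitrary: w rule: less_induct)
  case less
  obtain v where v: "(z, v) \<in> gp_le P" "covers (gp_le P) v w"
    using P_cover_below [OF P] less.prems by blast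
  have cover: "covers (adj_le P) (Old v) (Old w)"
    using v adj_covers_Old [OF P] by blast
  show ?case
  proof (cases "z = v")
    case True
    have up: "(Ivl x (Old y), Ivl x (Old z)) \<in> (tcheb_cover P)\<^sup>*"
      using tcheb_path_up [OF P yz s] .
    then have "Ivl x (Old z) \<in> tcheb_elts P"
      using s by (metis rtranclE tcheb_cover_rank [OF P])
    then have "(Ivl x (Old z), Ivl (Old z) (Old w)) \<in> tcheb_cover P"
      using cover True unfolding tcheb_cover_def by blast
    with up show ?thesis by simp
  next
    case False
    then have "Ivl (Old z) (Old v) \<in> tcheb_elts P"
      using v(1) by (simp add: tcheb_elts_def adj_le_def)
    then have "(Ivl (Old z) (Old v), Ivl (Old z) (Old w)) \<in> tcheb_cover P"
      using cover unfolding tcheb_cover_def by blast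
    moreover have "(Ivl x (Old y), Ivl (Old z) (Old v)) \<in> (tcheb_cover P)\<^sup>*"
      using less.hyps v False P_rank_cover [OF P v(2)] by simp
    ultimately show ?thesis by simp
  qed
qed

text \<open>
  A cover relation either keeps the left endpoint or replaces it by the current right endpoint,
  which lies above \<open>y\<close>.
\<close>

lemma tchebyshev_leD:
  assumes "(Ivl x (Old y), t) \<in> (tcheb_cover P)\<^sup>*" "Ivl x (Old y) \<in> tcheb_elts P"
  shows "t = TTop \<or> (\<exists>w. (y, w) \<in> gp_le P \<and> (t = Ivl x (Old w) \<or>
    (\<exists>z. t = Ivl (Old z) (Old w) \<and> (y, z) \<in> gp_le P \<and> (z, w) \<in> gp_le P \<and> z \<noteq> w)))"
  using assms(1)
proof induction
  case base
  have "(y, y) \<in> gp_le P"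
    using assms(2) P_refl [OF P] P_sub [OF P] by (auto simp: tcheb_elts_def adj_le_def)
  then show ?case by blast
next
  case (step t u)
  then have t: "t \<noteq> TTop"
    by (auto simp: tcheb_cover_def)
  then obtain z w where zw: "t = Ivl z (Old w)" "(y, w) \<in> gp_le P"
      "z = x \<or> (\<exists>z'. z = Old z' \<and> (y, z') \<in> gp_le P \<and> (z', w) \<in> gp_le P \<and> z' \<noteq> w)"
    using step.IH by blast
  consider "u = TTop" | v where "covers (adj_le P) (Old w) v" "u = Ivl (Old w) v \<or> u = Ivl z v"
    using step.hyps(2) zw(1) by (auto simp: tcheb_cover_def)
  then show ?case
  proof cases
    case 2
    then obtain v' where v: "v = Old v'" "(w, v') \<in> gp_le P" "w \<noteq> v'"
      by (cases v) (auto simp: covers_def adj_le_def)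
    then have "(y, v') \<in> gp_le P"
      using zw P_trans [OF P] by blast
    moreover have "(z', v') \<in> gp_le P \<and> z' \<noteq> v'" if "(z', w) \<in> gp_le P" for z'
      using v that P_trans [OF P] P_antisym [OF P] by blast
    ultimately show ?thesis
      using 2(2) v zw by blast
  qed simp
qed

text \<open>
  Grouping by the right endpoint \<open>w\<close> turns a sum over the transform into one over \<open>P\<close> as soon as
  the summand depends on right endpoints only.
\<close>

lemma strictly_above_tchebyshev:
  assumes s: "Ivl x (Old y) \<in> tcheb_elts P"
  shows "strictly_above (tchebyshev P) (Ivl x (Old y)) - {TTop} =
    (\<Union>w\<in>strictly_above P y. (\<lambda>z. Ivl z (Old w)) `
       insert x (Old ` {z. (y, z) \<in> gp_le P \<and> (z, w) \<in> gp_le P \<and> z \<noteq> w}))"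
    (is "?L = ?R")
proof (intro equalityI subsetI)
  fix t assume t: "t \<in> ?L"
  then have path: "(Ivl x (Old y), t) \<in> (tcheb_cover P)\<^sup>*" and "t \<noteq> TTop" "t \<noteq> Ivl x (Old y)"
    by (auto simp: strictly_above_def tchebyshev_def)
  then obtain w where w: "(y, w) \<in> gp_le P" "t = Ivl x (Old w) \<or>
      (\<exists>z. t = Ivl (Old z) (Old w) \<and> (y, z) \<in> gp_le P \<and> (z, w) \<in> gp_le P \<and> z \<noteq> w)"
    using tchebyshev_leD [OF path s] by blast
  moreover have "y \<noteq> w"
    using tcheb_path_rank [OF P path] \<open>t \<noteq> Ivl x (Old y)\<close> w(2) by auto
  ultimately show "t \<in> ?R"
    by (auto simp: strictly_above_def)
next
  fix t assume "t \<in> ?R"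
  then obtain w where w: "(y, w) \<in> gp_le P" "y \<noteq> w" and t: "t = Ivl x (Old w) \<or>
      (\<exists>z. t = Ivl (Old z) (Old w) \<and> (y, z) \<in> gp_le P \<and> (z, w) \<in> gp_le P \<and> z \<noteq> w)"
    by (auto simp: strictly_above_def)
  then have path: "(Ivl x (Old y), t) \<in> (tcheb_cover P)\<^sup>*"
    using tcheb_path_up [OF P w(1) s] tchebyshev_leI [OF s] by blast
  then have "t \<in> tcheb_elts P"
    using s by (metis rtranclE tcheb_cover_rank [OF P])
  then show "t \<in> ?L"
    using path s w(2) t by (auto simp: strictly_above_def tchebyshev_def)
qed

text \<open>
  The left endpoint \<open>x\<close>, which is not above \<open>y\<close>, stands in for the element \<open>w\<close> of the closed
  interval from \<open>y\<close> to \<open>w\<close>.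
\<close>

lemma card_tchebyshev_fibre:
  assumes s: "Ivl x (Old y) \<in> tcheb_elts P" and w: "w \<in> strictly_above P y"
  shows "card (insert x (Old ` {z. (y, z) \<in> gp_le P \<and> (z, w) \<in> gp_le P \<and> z \<noteq> w})) =
    card {z. (y, z) \<in> gp_le P \<and> (z, w) \<in> gp_le P}"
proof -
  let ?A = "{z. (y, z) \<in> gp_le P \<and> (z, w) \<in> gp_le P \<and> z \<noteq> w}"
  have "finite ?A"
    by (rule finite_subset [OF _ P_finite [OF P]]) (use P_sub [OF P] in blast)
  moreover have "x \<notin> Old ` ?A"
    using s P_antisym [OF P] by (auto simp: tcheb_elts_def adj_le_def)
  moreover have "{z. (y, z) \<in> gp_le P \<and> (z, w) \<in> gp_le P} = insert w ?A"
    using w P_refl [OF P] P_sub [OF P] by (auto simp: strictly_above_def)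
  ultimately show ?thesis
    by (simp add: card_image inj_on_def)
qed

end

section \<open>The ab-index of the Tchebyshev transform\<close>

text \<open>
  By induction, the summand of an interval \<open>[z, w]\<close> above \<open>[x, y]\<close> depends on \<open>w\<close> only, so that
  grouping by right endpoints gives the recursion in \<open>tcheb_op_capped_index\<close>.
\<close>

lemma upper_index_tchebyshev:
  assumes P: "graded_poset P" and "Ivl x (Old y) \<in> tcheb_elts P"
  shows "upper_index (tchebyshev P) (Ivl x (Old y)) = tcheb_op (capped_index P y)"
  using assms(2)
proof (induction "poset_rank P - gp_rank P y" arbitrary: x y rule: less_induct)
  case less
  let ?s = "Ivl x (Old y)"
  let ?fibre = "\<lambda>w. insert x (Old ` {z. (y, z) \<in> gp_le P \<and> (z, w) \<in> gp_le P \<and> z \<noteq> w})"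
  let ?e = "\<lambda>w. var_e ^ (gp_rank P w - gp_rank P y - 1) * var_b"
  define g where "g t = var_e ^ (tcheb_rank P t - gp_rank P y - 1) * var_b * upper_index (tchebyshev P) t"
    for t
  have y: "y \<in> gp_elts P"
    using less.prems P_sub [OF P] by (auto simp: tcheb_elts_def adj_le_def)
  have top: "gp_top (tchebyshev P) = TTop"
    by (rule gp_top_eq [OF tchebyshev_order [OF P] tchebyshev_is_top [OF P]])
  have simps: "gp_elts (tchebyshev P) = tcheb_elts P" "gp_rank (tchebyshev P) = tcheb_rank P"
    by (simp_all add: tchebyshev_def)
  have IH: "g (Ivl z (Old w)) = ?e w * tcheb_op (capped_index P w)"
    if w: "w \<in> strictly_above P y" and z: "z \<in> ?fibre w" for w z
  proof -
    have "y \<noteq> gp_top P" "w \<in> gp_elts P"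
      using w strictly_above_top [OF P] P_sub [OF P] by (auto simp: strictly_above_def)
    then have "poset_rank P - gp_rank P w < poset_rank P - gp_rank P y"
      using rank_less [OF P w] rank_top [OF P y] by simp
    moreover have "Ivl z (Old w) \<in> strictly_above (tchebyshev P) ?s"
      using strictly_above_tchebyshev [OF P less.prems] w z by blast
    then have "Ivl z (Old w) \<in> tcheb_elts P"
      by (simp add: strictly_above_def tchebyshev_def)
    ultimately show ?thesis
      unfolding g_def using less.hyps by simp
  qed
  have "upper_index (tchebyshev P) ?s = var_e ^ (poset_rank P - gp_rank P y) +
      sum g (strictly_above (tchebyshev P) ?s - {TTop})"
    using upper_index_rec [OF graded_poset_tchebyshev [OF P], of ?s] less.prems
    by (simp add: top simps poset_rank_tchebyshev [OF P] g_def)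
  also have "sum g (strictly_above (tchebyshev P) ?s - {TTop}) =
      (\<Sum>w\<in>strictly_above P y. sum g ((\<lambda>z. Ivl z (Old w)) ` ?fibre w))"
    unfolding strictly_above_tchebyshev [OF P less.prems]
  proof (rule sum.UNION_disjoint)
    show "\<forall>w\<in>strictly_above P y. finite ((\<lambda>z. Ivl z (Old w)) ` ?fibre w)"
      using finite_subset [OF _ P_finite [OF P]] P_sub [OF P]
      by (metis (no_types, lifting) finite_imageI finite_insert mem_Collect_eq subsetI)
  qed (use finite_strictly_above [OF P] in auto)
  also have "\<dots> = (\<Sum>w\<in>strictly_above P y.
      of_nat (card {z. (y, z) \<in> gp_le P \<and> (z, w) \<in> gp_le P}) * (?e w * tcheb_op (capped_index P w)))"
  proof (rule sum.cong [OF refl])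
    fix w assume w: "w \<in> strictly_above P y"
    have "sum g ((\<lambda>z. Ivl z (Old w)) ` ?fibre w) = (\<Sum>z\<in>?fibre w. g (Ivl z (Old w)))"
      by (subst sum.reindex) (auto simp: inj_on_def o_def)
    also have "\<dots> = (\<Sum>z\<in>?fibre w. ?e w * tcheb_op (capped_index P w))"
      by (rule sum.cong [OF refl IH [OF w]])
    also have "\<dots> = of_nat (card (?fibre w)) * (?e w * tcheb_op (capped_index P w))"
      by (rule sum_constant)
    finally show "sum g ((\<lambda>z. Ivl z (Old w)) ` ?fibre w) =
        of_nat (card {z. (y, z) \<in> gp_le P \<and> (z, w) \<in> gp_le P}) * (?e w * tcheb_op (capped_index P w))"
      by (simp only: card_tchebyshev_fibre [OF P less.prems w])
  qed
  also have "var_e ^ (poset_rank P - gp_rank P y) + \<dots> = tcheb_op (capped_index P y)"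
    by (rule tcheb_op_capped_index [OF P y, symmetric])
  finally show ?case .
qed

theorem theorem5p3:
  fixes P :: "'a gposet"
  assumes "graded_poset P"
    and "poset_rank P \<ge> 1"
  shows "ab_index (tchebyshev P) = tcheb_op (ab_index P * var_a)"
proof -
  note P = assms(1)
  have "gp_bot P \<noteq> gp_top P"
    using P_rank_bot [OF P] assms(2) by (auto simp: poset_rank_def)
  then have "capped_index P (gp_bot P) = ab_index P * var_a"
    by (simp add: capped_index_def ab_index_eq_upper_index)
  moreover have "Ivl MinusOne (Old (gp_bot P)) \<in> tcheb_elts P"
    using MinusOne_elt [OF P] P_bot [OF P] by (simp add: is_bot_def)
  moreover have "gp_bot (tchebyshev P) = Ivl MinusOne (Old (gp_bot P))"
    by (rule gp_bot_eq [OF tchebyshev_order [OF P] tchebyshev_is_bot [OF P]])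
  ultimately show ?thesis
    using upper_index_tchebyshev [OF P] by (simp add: ab_index_eq_upper_index)
qed

end
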